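(* Consider a network Cournot game with a system operator (NCGSO) on a market network $(A,B,c^-,c^+,H)$, with production cost functions $\Psi_i:\mathbb{R}_+^m\to\mathbb{R}_+$ ($i\in\mathcal N$), inverse demand functions $\Phi_j:\mathbb{R}\to\mathbb{R}$ ($j\in\mathcal M$), and welfare function $\omega:\mathbb{R}_+^{n\times m}\times\mathbb{R}^m\to\mathbb{R}$ such that: (i) each $\Psi_i$ is continuous, strictly increasing, convex, and $\Psi_i(0)=0$; (ii) each $\Phi_j$ is continuous, strictly decreasing, concave, and $\Phi_j(\bar z_j)=0$ for some finite $\bar z_j>0$; (iii) $\omega$ is continuous and, for every $x\in\mathbb{R}_+^{n\times m}$, the function $z\mapsto\omega(x,z)$ is concave on $\mathbb{R}^m$. Then a (pure-strategy) Nash equilibrium of the NCGSO exists.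
   Context: Market network. $\mathcal N=\{1,\dots,n\}$ is a nonempty finite set of producers, $\mathcal M=\{1,\dots,m\}$ a finite set of markets, $\mathcal L=\{1,\dots,l\}$ a finite set of links. Each link $k$ has a tail $\sigma_k\in\mathcal M$ and a head $\tau_k\in\mathcal M\setminus\{\sigma_k\}$ (parallel links are allowed). A market network is a tuple $(A,B,c^-,c^+,H)$ where: $A\in\{0,1\}^{n\times m}$ is the producer-market adjacency matrix ($A_{ij}=1$ iff producer $i$ can sell on market $j$; every producer can sell on at least one market); $B\in\{0,\pm1\}^{m\times l}$ is the market-link incidence matrix, $B_{jk}=1$ if $\tau_k=j$, $B_{jk}=-1$ if $\sigma_k=j$, $B_{jk}=0$ otherwise; $c^-,c^+\in\mathbb{R}_+^l$ are capacity vectors; $H\in\mathbb{R}^{l\times l}$ satisfies $BH=B$. Standing assumption: the market network is weakly connected, i.e. any two distinct markets are joined by a path of links ignoring orientation (equivalently $\mathrm{rank}(B)=m-1$). Game. The NCGSO has $n+1$ players: the system operator (player $0$) and the producers $1,\dots,n$. Producer $i$ has action set $\mathcal A_i=\{v\in\mathbb{R}_+^m: A_{ij}=0\Rightarrow v_j=0\}$, with actions $x_i=(x_{ij})_{j\in\mathcal M}$; $\mathcal X=\prod_{i\in\mathcal N}\mathcal A_i\subseteq\mathbb{R}_+^{n\times m}$. The system operator has action set $\mathcal Y=\{y\in\mathbb{R}^l: -c^-\le Hy\le c^+\}$ (entrywise). Let $\operatorname{diag}(A'x)\in\mathbb{R}^m$ be the vector with entries $\sum_{i\in\mathcal N}A_{ij}x_{ij}$.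 The utilities are $u_0(y,x)=\omega(x,\operatorname{diag}(A'x)+By)$ and, for $i\in\mathcal N$, $$u_i(x,y)=u_i(x_i,x_{-i},y)=\sum_{j\in\mathcal M}A_{ij}x_{ij}\,\Phi_j\Big(\sum_{h\in\mathcal N}A_{hj}x_{hj}+\sum_{k\in\mathcal L}B_{jk}y_k\Big)-\Psi_i(x_i),$$ where $x_{-i}$ denotes the actions of all producers other than $i$. A (pure-strategy) Nash equilibrium is $(x^*,y^* )\in\mathcal X\times\mathcal Y$ such that $y^*\in\arg\max_{y\in\mathcal Y}u_0(y,x^* )$ and, for every $i\in\mathcal N$, $x_i^*\in\arg\max_{x_i\in\mathcal A_i}u_i(x_i,x_{-i}^*,y^* )$. "Strictly increasing" for $\Psi_i$ means $\Psi_i(v)<\Psi_i(w)$ whenever $v\le w$ entrywise and $v\ne w$. *)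

theory Defs
  imports "HOL-Analysis.Analysis"
begin

text \<open>
  Producers and markets are the elements of the finite (nonempty) index types \<open>'n\<close> and \<open>'m\<close>.
  The links form a finite set \<open>links\<close> of elements of an arbitrary type \<open>'l\<close>, because
  there may be none: a network with a single market has no links. Vectors and matrices
  indexed by links are therefore functions, of which only the entries on \<open>links\<close> matter.
\<close>

record ('n, 'm, 'l) market_net =
  links :: "'l set"
  tail :: "'l \<Rightarrow> 'm"
  head :: "'l \<Rightarrow> 'm"
  adj :: "'n \<Rightarrow> 'm \<Rightarrow> real"
  inc :: "'m \<Rightarrow> 'l \<Rightarrow> real"
  cap_minus :: "'l \<Rightarrow> real"
  cap_plus :: "'l \<Rightarrow> real"
  flow_mat :: "'l \<Rightarrow> 'l \<Rightarrow> real"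

definition weakly_connected :: "('n, 'm, 'l) market_net \<Rightarrow> bool" where
  "weakly_connected N \<longleftrightarrow>
     (\<forall>i j. i \<noteq> j \<longrightarrow>
        (i, j) \<in> (\<Union>k\<in>links N. {(tail N k, head N k), (head N k, tail N k)})\<^sup>*)"

definition market_network :: "('n::finite, 'm::finite, 'l) market_net \<Rightarrow> bool" where
  "market_network N \<longleftrightarrow>
     finite (links N) \<and>
     (\<forall>k\<in>links N. head N k \<noteq> tail N k) \<and>
     (\<forall>i j. adj N i j \<in> {0, 1}) \<and>
     (\<forall>i. \<exists>j. adj N i j = 1) \<and>
     (\<forall>j. \<forall>k\<in>links N.
        inc N j k = (if head N k = j then 1 else if tail N k = j then - 1 else 0)) \<and>
     (\<forall>k\<in>links N. 0 \<le> cap_minus N k \<and> 0 \<le> cap_plus N k) \<and>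
     (\<forall>j. \<forall>k\<in>links N. (\<Sum>h\<in>links N. inc N j h * flow_mat N h k) = inc N j k) \<and>
     weakly_connected N"

definition producer_actions :: "('n, 'm::finite, 'l) market_net \<Rightarrow> 'n \<Rightarrow> (real ^ 'm) set" where
  "producer_actions N i = {v. 0 \<le> v \<and> (\<forall>j. adj N i j = 0 \<longrightarrow> v $ j = 0)}"

definition producer_profiles :: "('n::finite, 'm::finite, 'l) market_net \<Rightarrow> (real ^ 'm ^ 'n) set" where
  "producer_profiles N = {x. \<forall>i. x $ i \<in> producer_actions N i}"

text \<open>The vectors indexed by the links are represented by \<open>links N \<rightarrow>\<^sub>E UNIV\<close>.\<close>

definition operator_actions :: "('n, 'm, 'l) market_net \<Rightarrow> ('l \<Rightarrow> real) set" where
  "operator_actions N =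
     {y \<in> links N \<rightarrow>\<^sub>E UNIV. \<forall>k\<in>links N.
        - cap_minus N k \<le> (\<Sum>h\<in>links N. flow_mat N k h * y h) \<and>
        (\<Sum>h\<in>links N. flow_mat N k h * y h) \<le> cap_plus N k}"

text \<open>The vector \<open>diag(A' x) + B y\<close>.\<close>

definition market_supply ::
  "('n::finite, 'm::finite, 'l) market_net \<Rightarrow> real ^ 'm ^ 'n \<Rightarrow> ('l \<Rightarrow> real) \<Rightarrow> real ^ 'm" where
  "market_supply N x y =
     (\<chi> j. (\<Sum>h\<in>UNIV. adj N h j * x $ h $ j) + (\<Sum>k\<in>links N. inc N j k * y k))"

definition operator_utility ::
  "('n::finite, 'm::finite, 'l) market_net \<Rightarrow> (real ^ 'm ^ 'n \<Rightarrow> real ^ 'm \<Rightarrow> real) \<Rightarrow>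
   ('l \<Rightarrow> real) \<Rightarrow> real ^ 'm ^ 'n \<Rightarrow> real" where
  "operator_utility N \<omega> y x = \<omega> x (market_supply N x y)"

definition producer_utility ::
  "('n::finite, 'm::finite, 'l) market_net \<Rightarrow> ('n \<Rightarrow> real ^ 'm \<Rightarrow> real) \<Rightarrow> ('m \<Rightarrow> real \<Rightarrow> real) \<Rightarrow>
   'n \<Rightarrow> real ^ 'm ^ 'n \<Rightarrow> ('l \<Rightarrow> real) \<Rightarrow> real" where
  "producer_utility N \<Psi> \<Phi> i x y =
     (\<Sum>j\<in>UNIV. adj N i j * x $ i $ j * \<Phi> j (market_supply N x y $ j)) - \<Psi> i (x $ i)"

text \<open>The profile \<open>(v, x\<^sub>-\<^sub>i)\<close>.\<close>

definition deviate :: "real ^ 'm ^ 'n \<Rightarrow> 'n::finite \<Rightarrow> real ^ 'm \<Rightarrow> real ^ 'm ^ 'n" where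
  "deviate x i v = (\<chi> h. if h = i then v else x $ h)"

definition nash_equilibrium ::
  "('n::finite, 'm::finite, 'l) market_net \<Rightarrow> ('n \<Rightarrow> real ^ 'm \<Rightarrow> real) \<Rightarrow> ('m \<Rightarrow> real \<Rightarrow> real) \<Rightarrow>
   (real ^ 'm ^ 'n \<Rightarrow> real ^ 'm \<Rightarrow> real) \<Rightarrow> real ^ 'm ^ 'n \<Rightarrow> ('l \<Rightarrow> real) \<Rightarrow> bool" where
  "nash_equilibrium N \<Psi> \<Phi> \<omega> x y \<longleftrightarrow>
     x \<in> producer_profiles N \<and> y \<in> operator_actions N \<and>
     is_arg_max (\<lambda>y'. operator_utility N \<omega> y' x) (\<lambda>y'. y' \<in> operator_actions N) y \<and>
     (\<forall>i. is_arg_max (\<lambda>v. producer_utility N \<Psi> \<Phi> i (deviate x i v) y)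
            (\<lambda>v. v \<in> producer_actions N i) (x $ i))"

text \<open>
  On \<open>real ^ 'm\<close> the relation \<open>\<le>\<close> is entrywise and \<open>v < w\<close> means \<open>v \<le> w\<close> and \<open>v \<noteq> w\<close>, so
  \<open>{0..}\<close> is the nonnegative orthant and \<open>strict_mono_on\<close> refers to this strict order. On
  \<open>real ^ 'm ^ 'n\<close> the relation \<open>\<le>\<close> is again entrywise.
\<close>

definition admissible_cost :: "(real ^ 'm::finite \<Rightarrow> real) \<Rightarrow> bool" where
  "admissible_cost \<psi> \<longleftrightarrow>
     \<psi> ` {0..} \<subseteq> {0..} \<and> continuous_on {0..} \<psi> \<and> strict_mono_on {0..} \<psi> \<and>
     convex_on {0..} \<psi> \<and> \<psi> 0 = 0"

definition admissible_inverse_demand :: "(real \<Rightarrow> real) \<Rightarrow> bool" where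
  "admissible_inverse_demand \<phi> \<longleftrightarrow>
     continuous_on UNIV \<phi> \<and> strict_antimono_on UNIV \<phi> \<and> concave_on UNIV \<phi> \<and>
     (\<exists>z>0. \<phi> z = 0)"

definition admissible_welfare ::
  "(real ^ 'm::finite ^ 'n::finite \<Rightarrow> real ^ 'm \<Rightarrow> real) \<Rightarrow> bool" where
  "admissible_welfare \<omega> \<longleftrightarrow>
     continuous_on ({0..} \<times> UNIV) (\<lambda>(x, z). \<omega> x z) \<and> (\<forall>x\<ge>0. concave_on UNIV (\<omega> x))"

lemma less_vec_iff: "v < w \<longleftrightarrow> v \<le> w \<and> v \<noteq> w" for v w :: "real ^ 'm"
  by (simp add: order_less_le)

lemma mem_orthant_iff: "v \<in> {0..} \<longleftrightarrow> (\<forall>j. 0 \<le> v $ j)" for v :: "real ^ 'm"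
  by (simp add: less_eq_vec_def)

lemma mem_matrix_orthant_iff: "x \<in> {0..} \<longleftrightarrow> (\<forall>i j. 0 \<le> x $ i $ j)" for x :: "real ^ 'm ^ 'n"
  by (simp add: less_eq_vec_def)

end

theory Submission
  imports Defs
begin

text \<open>
  Since \<open>B H = B\<close>, the operator effectively chooses the net imports \<open>z = B y\<close> in a compact convex
  set, and concavity and monotonicity of the inverse demands make every producer's profit concave
  in the producer's own action. After truncating the production at a level beyond which all prices
  are nonpositive, an equilibrium is a profile \<open>s\<close> for which \<open>t \<mapsto> F s t\<close> is maximal at \<open>t = s\<close>, where
  the Nikaido-Isoda function \<open>F s t\<close> sums the payoffs of the unilateral deviations from \<open>s\<close> to \<open>t\<close>.
  Such an \<open>s\<close> exists by Ky Fan's inequality, which is derived from Brouwer's fixed point theorem.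
\<close>

section \<open>Ky Fan's inequality\<close>

text \<open>If every \<open>s\<close> had an improvement, a weighted mean of finitely many improvements, with weights
  given by the gains, would define a continuous self-map; concavity of \<open>F s\<close> contradicts its fixed
  point.\<close>

lemma ky_fan_inequality:
  fixes F :: "'a::euclidean_space \<Rightarrow> 'a \<Rightarrow> real"
  assumes S: "compact S" "convex S" "S \<noteq> {}"
    and cont: "\<And>t. t \<in> S \<Longrightarrow> continuous_on S (\<lambda>s. F s t)"
    and cont_diag: "continuous_on S (\<lambda>s. F s s)"
    and conc: "\<And>s. s \<in> S \<Longrightarrow> concave_on S (F s)"
  obtains s where "s \<in> S" "\<And>t. t \<in> S \<Longrightarrow> F s t \<le> F s s"
proof -
  have "\<exists>s\<in>S. \<forall>t\<in>S. F s t \<le> F s s"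
  proof (rule ccontr)
    assume "\<not> ?thesis"
    then have dev: "\<exists>t\<in>S. F s s < F s t" if "s \<in> S" for s
      using that by (simp add: not_le)
    \<comment> \<open>\<open>G t s\<close> is the gain from replacing \<open>s\<close> by
      \<open>t\<close>; the open set \<open>U t\<close> below meets \<open>S\<close> exactly where
      this gain is positive.\<close>
    define G where "G t s = F s t - F s s" for t s
    have contG: "continuous_on S (G t)" if "t \<in> S" for t
      unfolding G_def using cont[OF that] cont_diag by (rule continuous_on_diff)
    have "\<exists>U. open U \<and> U \<inter> S = G t -` {0<..} \<inter> S" if "t \<in> S" for t
      using contG[OF that] unfolding continuous_on_open_invariant by simp
    then obtain U where U: "\<And>t. t \<in> S \<Longrightarrow> open (U t) \<and> U t \<inter> S = G t -` {0<..} \<inter> S"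
      by metis
    have "S \<subseteq> (\<Union>t\<in>S. U t)"
    proof
      fix s assume s: "s \<in> S"
      with dev obtain t where "t \<in> S" "G t s > 0" unfolding G_def by force
      with U[of t] s show "s \<in> (\<Union>t\<in>S. U t)" by auto
    qed
    then obtain T where T: "T \<subseteq> S" "finite T" "S \<subseteq> (\<Union>t\<in>T. U t)"
      using compactE_image[OF S(1), of S U] U by auto
    define w where "w t s = max 0 (G t s)" for t s
    define W where "W s = (\<Sum>t\<in>T. w t s)" for s
    have contw: "continuous_on S (w t)" if "t \<in> T" for t
      unfolding w_def using contG that T(1) by (intro continuous_on_max continuous_on_const) auto
    have w0: "w t s \<ge> 0" for t s by (simp add: w_def)
    \<comment> \<open>By the finite subcover some gain is positive at every point of
      \<open>S\<close>, so the weights can be normalised without losing continuity.\<close>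
    have W: "W s > 0" if s: "s \<in> S" for s
    proof -
      obtain t where t: "t \<in> T" "s \<in> U t" using T s by blast
      then have "G t s > 0" using U[of t] s T(1) by auto
      then show ?thesis unfolding W_def
        by (intro sum_pos2[OF T(2) t(1)]) (auto simp: w_def)
    qed
    define f where "f s = (\<Sum>t\<in>T. (w t s / W s) *\<^sub>R t)" for s
    have Tne: "T \<noteq> {}" using T S by auto
    have W1: "(\<Sum>t\<in>T. w t s / W s) = 1" if "s \<in> S" for s
      using W[OF that] by (simp add: W_def flip: sum_divide_distrib)
    have "continuous_on S W"
      unfolding W_def using contw by (rule continuous_on_sum)
    then have "continuous_on S f"
      unfolding f_def using contw W
      by (intro continuous_on_sum continuous_on_scaleR continuous_on_divide continuous_on_const) force+
    moreover have "f \<in> S \<rightarrow> S"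
    proof
      fix s assume s: "s \<in> S"
      show "f s \<in> S" unfolding f_def
        using T W[OF s] w0 S(2) W1[OF s] by (intro convex_sum) auto
    qed
    ultimately obtain s where s: "s \<in> S" "f s = s"
      using brouwer[OF S] by blast
    \<comment> \<open>At the fixed point, concavity bounds the weighted mean of the values
      \<open>F s t\<close> by \<open>F s s\<close>, so the mean gain is nonpositive.\<close>
    have "(\<Sum>t\<in>T. (w t s / W s) * F s t) \<le> F s (f s)"
      unfolding f_def
      using T Tne W[OF s(1)] w0 W1[OF s(1)] conc[OF s(1)] by (intro concave_on_sum[where C = S]) auto
    also have "F s (f s) = (\<Sum>t\<in>T. w t s / W s) * F s s"
      using s W1 by simp
    also have "\<dots> = (\<Sum>t\<in>T. (w t s / W s) * F s s)"
      by (rule sum_distrib_right)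
    finally have "(\<Sum>t\<in>T. (w t s / W s) * G t s) \<le> 0"
      by (simp add: G_def right_diff_distrib sum_subtractf)
    \<comment> \<open>A weight vanishes wherever its gain is negative, so no summand is negative,
      and the covering provides a positive one.\<close>
    moreover have "(\<Sum>t\<in>T. (w t s / W s) * G t s) > 0"
    proof -
      obtain t where t: "t \<in> T" "s \<in> U t" using T s by blast
      then have "G t s > 0" using U[of t] s T(1) by auto
      then show ?thesis using W[OF s(1)]
        by (intro sum_pos2[OF T(2) t(1)]) (auto simp: w_def max_def)
    qed
    ultimately show False by simp
  qed
  with that show thesis by blast
qed

section \<open>Elimination of variables from linear inequalities\<close>

text \<open>Supplies the value of an eliminated variable from its finitely many lower and upper
  bounds.\<close>

lemma between_finite_families:
  fixes u :: "'a \<Rightarrow> real" and v :: "'b \<Rightarrow> real"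
  assumes "finite P" "finite Q" and le: "\<And>p q. p \<in> P \<Longrightarrow> q \<in> Q \<Longrightarrow> u p \<le> v q"
  shows "\<exists>t. (\<forall>p\<in>P. u p \<le> t) \<and> (\<forall>q\<in>Q. t \<le> v q)"
proof (cases "P = {}")
  case True
  \<comment> \<open>\<open>Q\<close> may be empty too; \<open>Min\<close> of the empty set is then
    an unspecified real, and both conditions are vacuous.\<close>
  then show ?thesis using assms(2) by (intro exI[of _ "Min (v ` Q)"]) simp
next
  case False
  then show ?thesis using assms by (intro exI[of _ "Max (u ` P)"]) simp
qed

text \<open>The links need not form a finite type, so the projection of the polyhedron of feasible
  flows is shown to be closed by Fourier-Motzkin elimination of one flow variable at a time.\<close>

lemma closed_projection_linear_system:
  fixes C :: "(('a::topological_space \<Rightarrow> real) \<times> ('l \<Rightarrow> real)) set"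
  assumes "finite L" "finite C" "\<And>c. c \<in> C \<Longrightarrow> continuous_on UNIV (fst c)"
  shows "closed {z. \<exists>y. \<forall>c\<in>C. fst c z \<le> (\<Sum>k\<in>L. snd c k * y k)}"
  using assms
proof (induction L arbitrary: C rule: finite_induct)
  case empty
  have "{z. \<exists>y::'l \<Rightarrow> real. \<forall>c\<in>C. fst c z \<le> (\<Sum>k\<in>{}. snd c k * y k)} = (\<Inter>c\<in>C. {z. fst c z \<le> 0})"
    by auto
  then show ?case using empty by (auto intro!: closed_INT closed_Collect_le)
next
  case (insert k L)
  define P where "P = {c \<in> C. snd c k > 0}"
  define Q where "Q = {c \<in> C. snd c k < 0}"
  define O0 where "O0 = {c \<in> C. snd c k = 0}"
  \<comment> \<open>Both multipliers \<open>- snd q k\<close> and \<open>snd p k\<close> are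
    positive, so each combination follows from its two constraints, and its coefficient at
    \<open>k\<close> is zero.\<close>
  define D where "D = O0 \<union> (\<lambda>(p, q).
      (\<lambda>z. - snd q k * fst p z + snd p k * fst q z,
       \<lambda>h. - snd q k * snd p h + snd p k * snd q h)) ` (P \<times> Q)"
  have fin: "finite P" "finite Q" "finite O0"
    using insert.prems by (auto simp: P_def Q_def O0_def)
  have "{z::'a. \<exists>y. \<forall>c\<in>C. fst c z \<le> (\<Sum>h\<in>insert k L. snd c h * y h)} =
        {z::'a. \<exists>y. \<forall>c\<in>D. fst c z \<le> (\<Sum>h\<in>L. snd c h * y h)}" (is "?A = ?B")
  proof (intro set_eqI)
    fix z :: 'a
    \<comment> \<open>With the other variables moved to the left, constraint \<open>c\<close> reads
      \<open>g c y \<le> snd c k * y k\<close>.\<close>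
    define g where "g c y = fst c z - (\<Sum>h\<in>L. snd c h * y h)" for c and y :: "'l \<Rightarrow> real"
    have A: "z \<in> ?A \<longleftrightarrow> (\<exists>y. \<forall>c\<in>C. g c y \<le> snd c k * y k)"
      using insert.hyps by (simp add: g_def algebra_simps)
    have "z \<in> ?B \<longleftrightarrow> (\<exists>y. (\<forall>c\<in>O0. g c y \<le> 0) \<and>
        (\<forall>p\<in>P. \<forall>q\<in>Q. - snd q k * g p y + snd p k * g q y \<le> 0))"
      by (simp add: D_def g_def ball_Un algebra_simps sum.distrib sum_distrib_left sum_subtractf sum_negf)
    also have "\<dots> \<longleftrightarrow> z \<in> ?A"
    proof
      assume "\<exists>y. (\<forall>c\<in>O0. g c y \<le> 0) \<and>
        (\<forall>p\<in>P. \<forall>q\<in>Q. - snd q k * g p y + snd p k * g q y \<le> 0)"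
      then obtain y where y0: "\<And>c. c \<in> O0 \<Longrightarrow> g c y \<le> 0"
        and ypq: "\<And>p q. p \<in> P \<Longrightarrow> q \<in> Q \<Longrightarrow> - snd q k * g p y + snd p k * g q y \<le> 0"
        by blast
      \<comment> \<open>Constraints in \<open>P\<close> bound the value at \<open>k\<close> from
        below, those in \<open>Q\<close> from above, because dividing by a negative coefficient
        reverses them.\<close>
      have "g p y / snd p k \<le> g q y / snd q k" if "p \<in> P" "q \<in> Q" for p q
        using ypq[OF that] that by (simp add: P_def Q_def field_simps)
      then obtain t where t: "\<And>p. p \<in> P \<Longrightarrow> g p y / snd p k \<le> t"
          "\<And>q. q \<in> Q \<Longrightarrow> t \<le> g q y / snd q k"
        using between_finite_families[OF fin(1,2),
            of "\<lambda>p. g p y / snd p k" "\<lambda>q. g q y / snd q k"] by blast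
      have gt: "g c (y(k := t)) = g c y" for c
        unfolding g_def using insert.hyps by (auto intro!: sum.cong)
      have "g c y \<le> snd c k * t" if c: "c \<in> C" for c
      proof -
        consider "c \<in> P" | "c \<in> Q" | "c \<in> O0"
          using c by (force simp: P_def Q_def O0_def)
        then show ?thesis
        proof cases
          case 1 with t(1)[OF 1] show ?thesis by (simp add: P_def field_simps)
        next
          case 2 with t(2)[OF 2] show ?thesis by (simp add: Q_def field_simps)
        next
          case 3 with y0[OF 3] show ?thesis by (simp add: O0_def)
        qed
      qed
      then show "z \<in> ?A" unfolding A by (intro exI[of _ "y(k := t)"]) (simp add: gt)
    next
      assume "z \<in> ?A"
      then obtain y where y: "\<And>c. c \<in> C \<Longrightarrow> g c y \<le> snd c k * y k" unfolding A by blast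
      have "g c y \<le> 0" if "c \<in> O0" for c using y[of c] that by (simp add: O0_def)
      moreover have "- snd q k * g p y + snd p k * g q y \<le> 0" if "p \<in> P" "q \<in> Q" for p q
      proof -
        have "- snd q k * g p y \<le> - snd q k * (snd p k * y k)"
          using y[of p] that by (intro mult_left_mono) (auto simp: P_def Q_def)
        moreover have "snd p k * g q y \<le> snd p k * (snd q k * y k)"
          using y[of q] that by (intro mult_left_mono) (auto simp: P_def Q_def)
        ultimately show ?thesis by (simp add: algebra_simps)
      qed
      ultimately show "\<exists>y. (\<forall>c\<in>O0. g c y \<le> 0) \<and>
        (\<forall>p\<in>P. \<forall>q\<in>Q. - snd q k * g p y + snd p k * g q y \<le> 0)" by blast
    qed
    finally show "z \<in> ?A \<longleftrightarrow> z \<in> ?B" by simp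
  qed
  moreover have "closed ?B"
  proof (rule insert.IH)
    show "finite D" using fin by (simp add: D_def)
    show "continuous_on UNIV (fst c)" if "c \<in> D" for c
    proof -
      from that consider "c \<in> C" | p q where "p \<in> C" "q \<in> C"
          "fst c = (\<lambda>z. - snd q k * fst p z + snd p k * fst q z)"
        by (auto simp: D_def O0_def P_def Q_def)
      then show ?thesis
      proof cases
        case 1
        then show ?thesis by (rule insert.prems(2))
      next
        case 2
        then show ?thesis
          by (simp only:) (intro continuous_on_add continuous_on_mult continuous_on_const insert.prems(2))
      qed
    qed
  qed
  ultimately show ?case by simp
qed

section \<open>Concavity tools\<close>

text \<open>Concavity involves only weights with sum 1, so \<open>g\<close> may include a
  translation.\<close>

lemma concave_on_affine_comp:
  assumes f: "concave_on T f" and S: "convex S" "g ` S \<subseteq> T"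
    and g: "\<And>a b u v. u + v = 1 \<Longrightarrow> g (u *\<^sub>R a + v *\<^sub>R b) = u *\<^sub>R g a + v *\<^sub>R g b"
  shows "concave_on S (\<lambda>x. f (g x))"
  using assms unfolding concave_on_iff by (auto simp: image_subset_iff)

lemma concave_on_finite_sum:
  assumes "finite I" "convex S" "\<And>i. i \<in> I \<Longrightarrow> concave_on S (f i)"
  shows "concave_on S (\<lambda>x. \<Sum>i\<in>I. f i x)"
  using assms by (induction I rule: finite_induct) (auto simp: concave_on_const intro: concave_on_add)

text \<open>Concavity of \<phi> can be multiplied by the nonnegative quantity sold. The surplus
  \<open>u * v * ((b - a) * (\<phi> (a + c) - \<phi> (b + c)))\<close> that then appears is
  nonnegative, since quantity and price move in opposite directions.\<close>

lemma concave_on_revenue: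
  fixes \<phi> :: "real \<Rightarrow> real"
  assumes conc: "concave_on UNIV \<phi>" and anti: "antimono \<phi>"
  shows "concave_on {0..} (\<lambda>w. w * \<phi> (w + c))"
  unfolding concave_on_iff
proof (intro conjI ballI allI impI)
  fix a b u v :: real
  assume ab: "a \<in> {0..}" "b \<in> {0..}" and uv: "0 \<le> u" "0 \<le> v" "u + v = 1"
  let ?x = "u * a + v * b"
  have "?x + c = u * (a + c) + v * (b + c)" using uv by algebra
  then have "u * \<phi> (a + c) + v * \<phi> (b + c) \<le> \<phi> (?x + c)"
    using conc uv unfolding concave_on_iff by simp
  then have "?x * (u * \<phi> (a + c) + v * \<phi> (b + c)) \<le> ?x * \<phi> (?x + c)"
    using ab uv by (intro mult_left_mono) auto
  moreover have "?x * (u * \<phi> (a + c) + v * \<phi> (b + c)) =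
      u * (a * \<phi> (a + c)) + v * (b * \<phi> (b + c)) + u * v * ((b - a) * (\<phi> (a + c) - \<phi> (b + c)))"
    using uv(3) by algebra
  moreover have D: "(b - a) * (\<phi> (a + c) - \<phi> (b + c)) \<ge> 0"
    using antimonoD[OF anti, of "a + c" "b + c"] antimonoD[OF anti, of "b + c" "a + c"]
    by (cases "a \<le> b") (auto intro: mult_nonpos_nonpos)
  ultimately show "u * (a * \<phi> (a + c)) + v * (b * \<phi> (b + c))
      \<le> (u *\<^sub>R a + v *\<^sub>R b) * \<phi> (u *\<^sub>R a + v *\<^sub>R b + c)"
    using mult_nonneg_nonneg[OF mult_nonneg_nonneg[OF uv(1,2)] D] by simp
qed auto

section \<open>The compact convex set of feasible net imports\<close>

definition net_import :: "('n, 'm::finite, 'l) market_net \<Rightarrow> ('l \<Rightarrow> real) \<Rightarrow> real ^ 'm" where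
  "net_import N y = (\<chi> j. \<Sum>k\<in>links N. inc N j k * y k)"

definition feasible_imports :: "('n, 'm::finite, 'l) market_net \<Rightarrow> (real ^ 'm) set" where
  "feasible_imports N = net_import N ` operator_actions N"

lemma feasible_imports_eq:
  "feasible_imports N = {z. \<exists>y.
     (\<forall>j. z $ j = (\<Sum>k\<in>links N. inc N j k * y k)) \<and>
     (\<forall>k\<in>links N. - cap_minus N k \<le> (\<Sum>h\<in>links N. flow_mat N k h * y h) \<and>
        (\<Sum>h\<in>links N. flow_mat N k h * y h) \<le> cap_plus N k)}" (is "_ = ?R")
proof (intro set_eqI iffI)
  fix z assume "z \<in> feasible_imports N"
  then show "z \<in> ?R"
    by (auto simp: feasible_imports_def net_import_def operator_actions_def)
next
  fix z assume "z \<in> ?R"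
  then obtain y where y: "\<forall>j. z $ j = (\<Sum>k\<in>links N. inc N j k * y k)"
     "\<forall>k\<in>links N. - cap_minus N k \<le> (\<Sum>h\<in>links N. flow_mat N k h * y h) \<and>
        (\<Sum>h\<in>links N. flow_mat N k h * y h) \<le> cap_plus N k" by blast
  have "restrict y (links N) \<in> operator_actions N"
    using y(2) by (simp add: operator_actions_def cong: sum.cong)
  moreover have "z = net_import N (restrict y (links N))"
    using y(1) by (simp add: net_import_def vec_eq_iff cong: sum.cong)
  ultimately show "z \<in> feasible_imports N" by (auto simp: feasible_imports_def)
qed

context
  fixes N :: "('n::finite, 'm::finite, 'l) market_net"
  assumes net: "market_network N"
begin

lemma finite_links: "finite (links N)"
  and adj_cases: "adj N i j = 0 \<or> adj N i j = 1"
  using net by (auto simp: market_network_def)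

lemma zero_feasible_import: "0 \<in> feasible_imports N"
  using net unfolding feasible_imports_eq market_network_def
  by (auto intro!: exI[of _ "\<lambda>_. 0"])

lemma convex_feasible_imports: "convex (feasible_imports N)"
proof (rule convexI)
  fix z1 z2 and u v :: real
  assume z: "z1 \<in> feasible_imports N" "z2 \<in> feasible_imports N"
    and uv: "0 \<le> u" "0 \<le> v" "u + v = 1"
  obtain y1 where y1: "\<forall>j. z1 $ j = (\<Sum>k\<in>links N. inc N j k * y1 k)"
     "\<forall>k\<in>links N. - cap_minus N k \<le> (\<Sum>h\<in>links N. flow_mat N k h * y1 h) \<and>
        (\<Sum>h\<in>links N. flow_mat N k h * y1 h) \<le> cap_plus N k"
    using z(1) unfolding feasible_imports_eq by blast
  obtain y2 where y2: "\<forall>j. z2 $ j = (\<Sum>k\<in>links N. inc N j k * y2 k)"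
     "\<forall>k\<in>links N. - cap_minus N k \<le> (\<Sum>h\<in>links N. flow_mat N k h * y2 h) \<and>
        (\<Sum>h\<in>links N. flow_mat N k h * y2 h) \<le> cap_plus N k"
    using z(2) unfolding feasible_imports_eq by blast
  have lin: "(\<Sum>k\<in>links N. a k * (u * y1 k + v * y2 k)) =
      u * (\<Sum>k\<in>links N. a k * y1 k) + v * (\<Sum>k\<in>links N. a k * y2 k)" for a
    by (simp add: sum_distrib_left sum.distrib algebra_simps)
  show "u *\<^sub>R z1 + v *\<^sub>R z2 \<in> feasible_imports N"
    unfolding feasible_imports_eq
  proof (intro CollectI exI[of _ "\<lambda>k. u * y1 k + v * y2 k"] conjI allI ballI)
    fix j show "(u *\<^sub>R z1 + v *\<^sub>R z2) $ j = (\<Sum>k\<in>links N. inc N j k * (u * y1 k + v * y2 k))"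
      unfolding lin using y1(1) y2(1) by simp
  next
    fix k assume "k \<in> links N"
    with y1(2) y2(2) have cap:
      "- (\<Sum>h\<in>links N. flow_mat N k h * y1 h) \<le> cap_minus N k"
      "- (\<Sum>h\<in>links N. flow_mat N k h * y2 h) \<le> cap_minus N k"
      "(\<Sum>h\<in>links N. flow_mat N k h * y1 h) \<le> cap_plus N k"
      "(\<Sum>h\<in>links N. flow_mat N k h * y2 h) \<le> cap_plus N k"
      by (simp_all add: minus_le_iff)
    show "- cap_minus N k \<le> (\<Sum>h\<in>links N. flow_mat N k h * (u * y1 h + v * y2 h))"
      unfolding lin using convex_bound_le[OF cap(1,2) uv] by simp
    show "(\<Sum>h\<in>links N. flow_mat N k h * (u * y1 h + v * y2 h)) \<le> cap_plus N k"
      unfolding lin by (rule convex_bound_le[OF cap(3,4) uv])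
  qed
qed

lemma closed_feasible_imports: "closed (feasible_imports N)"
proof -
  \<comment> \<open>Equations and two-sided capacity bounds become pairs of inequalities with a
    function of \<open>z\<close>, possibly constant, on the left and a linear form in the flow on
    the right.\<close>
  define C :: "((real ^ 'm \<Rightarrow> real) \<times> ('l \<Rightarrow> real)) set" where "C =
      range (\<lambda>j. (\<lambda>z. z $ j, inc N j)) \<union>
      range (\<lambda>j. (\<lambda>z. - z $ j, \<lambda>k. - inc N j k)) \<union>
      (\<lambda>k. (\<lambda>z. - cap_minus N k, flow_mat N k)) ` links N \<union>
      (\<lambda>k. (\<lambda>z. - cap_plus N k, \<lambda>h. - flow_mat N k h)) ` links N"
  have "feasible_imports N = {z. \<exists>y. \<forall>c\<in>C. fst c z \<le> (\<Sum>k\<in>links N. snd c k * y k)}"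
    unfolding feasible_imports_eq C_def
    by (simp add: ball_Un sum_negf) (auto intro!: Collect_cong ex_cong1 simp: order_eq_iff)
  moreover have "closed {z. \<exists>y. \<forall>c\<in>C. fst c z \<le> (\<Sum>k\<in>links N. snd c k * y k)}"
    by (intro closed_projection_linear_system finite_links)
      (auto simp: C_def finite_links intro!: continuous_intros)
  ultimately show ?thesis by simp
qed

text \<open>The feasible flows need not be bounded, but \<open>B y = B (H y)\<close>, where the
  entries of \<open>H y\<close> lie within the capacities and those of \<open>B\<close> between -1
  and 1.\<close>

lemma feasible_imports_bound:
  assumes "z \<in> feasible_imports N"
  shows "\<bar>z $ j\<bar> \<le> (\<Sum>k\<in>links N. cap_minus N k + cap_plus N k)"
proof -
  obtain y where y: "\<forall>j. z $ j = (\<Sum>k\<in>links N. inc N j k * y k)"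
     "\<forall>k\<in>links N. - cap_minus N k \<le> (\<Sum>h\<in>links N. flow_mat N k h * y h) \<and>
        (\<Sum>h\<in>links N. flow_mat N k h * y h) \<le> cap_plus N k"
    using assms unfolding feasible_imports_eq by blast
  have BH: "(\<Sum>h\<in>links N. inc N j h * flow_mat N h k) = inc N j k" if "k \<in> links N" for k
    using net that unfolding market_network_def by blast
  have "inc N j k = (if head N k = j then 1 else if tail N k = j then - 1 else 0)"
    if "k \<in> links N" for k
    using net that unfolding market_network_def by blast
  then have inc: "\<bar>inc N j k\<bar> \<le> 1" if "k \<in> links N" for k
    using that by simp
  have cap: "0 \<le> cap_minus N k" "0 \<le> cap_plus N k" if "k \<in> links N" for k
    using net that unfolding market_network_def by blast+
  have "z $ j = (\<Sum>k\<in>links N. (\<Sum>h\<in>links N. inc N j h * flow_mat N h k) * y k)"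
    using y(1) BH by simp
  also have "\<dots> = (\<Sum>k\<in>links N. inc N j k * (\<Sum>h\<in>links N. flow_mat N k h * y h))"
    by (simp add: sum_distrib_left sum_distrib_right mult.assoc) (rule sum.swap)
  also have "\<bar>\<dots>\<bar> \<le> (\<Sum>k\<in>links N. cap_minus N k + cap_plus N k)"
  proof (rule order_trans[OF sum_abs], rule sum_mono)
    fix k assume k: "k \<in> links N"
    have "\<bar>\<Sum>h\<in>links N. flow_mat N k h * y h\<bar> \<le> cap_minus N k + cap_plus N k"
      using y(2) k cap[OF k] by (force simp: abs_le_iff)
    with mult_mono[OF inc[OF k] this]
    show "\<bar>inc N j k * (\<Sum>h\<in>links N. flow_mat N k h * y h)\<bar> \<le> cap_minus N k + cap_plus N k"
      by (simp add: abs_mult)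
  qed
  finally show ?thesis .
qed

lemma compact_feasible_imports: "compact (feasible_imports N)"
proof -
  let ?M = "\<Sum>k\<in>links N. cap_minus N k + cap_plus N k"
  have "feasible_imports N \<subseteq> {(\<chi> j. - ?M)..(\<chi> j. ?M)}"
    using feasible_imports_bound by (auto simp: less_eq_vec_def abs_le_iff minus_le_iff)
  then have "bounded (feasible_imports N)"
    by (rule bounded_subset[OF compact_imp_bounded[OF compact_interval]])
  then show ?thesis using closed_feasible_imports by (simp add: compact_eq_bounded_closed)
qed

end

section \<open>Profits in terms of sales and net imports\<close>

definition sales :: "('n::finite, 'm::finite, 'l) market_net \<Rightarrow> real ^ 'm ^ 'n \<Rightarrow> real ^ 'm" where
  "sales N x = (\<chi> j. \<Sum>h\<in>UNIV. adj N h j * x $ h $ j)"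

text \<open>The sum over \<open>-{i}\<close> ignores row \<open>i\<close> of \<open>x\<close>: the
  own action enters only through \<open>v\<close>, and the operator only through
  \<open>z\<close>.\<close>

definition profit ::
  "('n::finite, 'm::finite, 'l) market_net \<Rightarrow> ('n \<Rightarrow> real ^ 'm \<Rightarrow> real) \<Rightarrow> ('m \<Rightarrow> real \<Rightarrow> real) \<Rightarrow>
   'n \<Rightarrow> real ^ 'm \<Rightarrow> real ^ 'm ^ 'n \<Rightarrow> real ^ 'm \<Rightarrow> real" where
  "profit N \<Psi> \<Phi> i v x z =
     (\<Sum>j\<in>UNIV. adj N i j * v $ j *
        \<Phi> j (adj N i j * v $ j + ((\<Sum>h\<in>-{i}. adj N h j * x $ h $ j) + z $ j))) - \<Psi> i v"

lemma market_supply_eq: "market_supply N x y = sales N x + net_import N y"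
  by (simp add: market_supply_def sales_def net_import_def vec_eq_iff)

lemma producer_utility_deviate:
  "producer_utility N \<Psi> \<Phi> i (deviate x i v) y = profit N \<Psi> \<Phi> i v x (net_import N y)"
proof -
  have "sales N (deviate x i v) $ j = adj N i j * v $ j + (\<Sum>h\<in>-{i}. adj N h j * x $ h $ j)" for j
    by (simp add: sales_def sum.remove[of UNIV i] deviate_def Compl_eq_Diff_UNIV)
  then show ?thesis
    by (simp add: producer_utility_def profit_def market_supply_eq deviate_def add.assoc)
qed

lemma convex_orthant: "convex {0::real ^ 'm..}"
  by (auto simp: convex_def less_eq_vec_def)

lemma antimono_inverse_demand: "admissible_inverse_demand \<phi> \<Longrightarrow> antimono \<phi>"
  unfolding admissible_inverse_demand_def monotone_on_def by (metis UNIV_I order.order_iff_strict)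

text \<open>In each market the rivals' sales and the imports form the constant shift of
  \<open>concave_on_revenue\<close>; an adjacency entry 0 or 1 makes own sales nonnegative and
  linear in \<open>v\<close>.\<close>

lemma concave_on_profit:
  assumes "market_network N" "admissible_cost (\<Psi> i)" "\<And>j. admissible_inverse_demand (\<Phi> j)"
  shows "concave_on {0..} (\<lambda>v. profit N \<Psi> \<Phi> i v x z)"
  unfolding profit_def
proof (intro concave_on_diff concave_on_finite_sum convex_orthant)
  fix j
  show "concave_on {0..} (\<lambda>v::real^_. adj N i j * v $ j *
        \<Phi> j (adj N i j * v $ j + ((\<Sum>h\<in>-{i}. adj N h j * x $ h $ j) + z $ j)))"
    using assms(3)[of j] adj_cases[OF assms(1), of i j]
    by (intro concave_on_affine_comp[OF concave_on_revenue] convex_orthant antimono_inverse_demand)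
      (auto simp: admissible_inverse_demand_def less_eq_vec_def algebra_simps)
qed (use assms in \<open>auto simp: admissible_cost_def\<close>)

text \<open>All three arguments vary with a parameter, which covers fixed deviations and the
  diagonal alike.\<close>

lemma continuous_on_profit:
  assumes "admissible_cost (\<Psi> i)" "\<And>j. admissible_inverse_demand (\<Phi> j)"
    and "continuous_on S v" "v ` S \<subseteq> {0..}" "continuous_on S x" "continuous_on S z"
  shows "continuous_on S (\<lambda>s. profit N \<Psi> \<Phi> i (v s) (x s) (z s))"
proof -
  have cont_cost: "continuous_on S (\<lambda>s. \<Psi> i (v s))"
    using assms by (auto simp: admissible_cost_def intro: continuous_on_compose2)
  have cont_dem: "continuous_on S (\<lambda>s. \<Phi> j (f s))" if "continuous_on S f" for f j
    using assms(2)[of j] that continuous_on_compose2[of UNIV "\<Phi> j" S f]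
    by (simp add: admissible_inverse_demand_def)
  have "continuous_on S (\<lambda>s. \<Phi> j (adj N i j * v s $ j +
      ((\<Sum>h\<in>-{i}. adj N h j * x s $ h $ j) + z s $ j)))" for j
    using assms(3,5,6)
    by (intro cont_dem continuous_on_sum continuous_on_mult continuous_on_add
        continuous_on_const continuous_on_component)
  then show ?thesis
    unfolding profit_def using assms(3) cont_cost
    by (intro continuous_on_diff continuous_on_sum continuous_on_mult
        continuous_on_const continuous_on_component)
qed

text \<open>Above the level \<open>R\<close> prices are nonpositive, so selling only \<open>R\<close> there neither lowers
  the revenue nor raises the cost.\<close>

lemma profit_truncate:
  assumes N: "market_network N" and cost: "admissible_cost (\<Psi> i)"
    and dem: "\<And>j. admissible_inverse_demand (\<Phi> j)"
    and x: "0 \<le> x" and v: "0 \<le> v" and R: "0 \<le> R"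
    and price: "\<And>j. \<Phi> j (R + z $ j) \<le> 0"
  shows "profit N \<Psi> \<Phi> i v x z \<le> profit N \<Psi> \<Phi> i (\<chi> j. min (v $ j) R) x z"
proof -
  let ?w = "(\<chi> j. min (v $ j) R)"
  define c where "c j = (\<Sum>h\<in>-{i}. adj N h j * x $ h $ j) + z $ j" for j
  have "\<Psi> i ?w \<le> \<Psi> i v"
  proof -
    have "?w \<le> v" "0 \<le> ?w" using v R by (auto simp: less_eq_vec_def)
    then show ?thesis
      using cost v unfolding admissible_cost_def monotone_on_def
      by (cases "?w = v") (auto simp: less_vec_iff intro!: less_imp_le)
  qed
  moreover have "adj N i j * v $ j * \<Phi> j (adj N i j * v $ j + c j)
      \<le> adj N i j * ?w $ j * \<Phi> j (adj N i j * ?w $ j + c j)" for j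
  proof (cases "adj N i j = 1 \<and> R < v $ j")
    case True
    have anti: "antimono (\<Phi> j)" using dem by (rule antimono_inverse_demand)
    have "0 \<le> adj N h j" for h using adj_cases[OF N, of h j] by auto
    \<comment> \<open>Rivals' sales are nonnegative, so they can only lower the price
      further.\<close>
    then have "z $ j \<le> c j"
      unfolding c_def using x by (auto simp: less_eq_vec_def intro!: sum_nonneg mult_nonneg_nonneg)
    then have "\<Phi> j (R + c j) \<le> 0"
      using price[of j] antimonoD[OF anti, of "R + z $ j" "R + c j"] by simp
    moreover have "\<Phi> j (v $ j + c j) \<le> \<Phi> j (R + c j)"
      using antimonoD[OF anti] True by simp
    \<comment> \<open>The intermediate term is \<open>v $ j * \<Phi> j (R + c j)\<close>: first the
      price is raised, then the factor of a nonpositive price is reduced.\<close>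
    ultimately have "v $ j * \<Phi> j (v $ j + c j) \<le> R * \<Phi> j (R + c j)"
      using True R by (smt (verit) mult_left_mono mult_right_mono_neg)
    then show ?thesis using True by (simp add: min_def)
  next
    case False
    then show ?thesis using adj_cases[OF N, of i j] by (auto simp: min_def)
  qed
  ultimately show ?thesis
    unfolding profit_def c_def by (intro diff_mono sum_mono)
qed

section \<open>Existence of an equilibrium\<close>

theorem theorem1:
  fixes N :: "('n::finite, 'm::finite, 'l) market_net"
    and \<Psi> :: "'n \<Rightarrow> real ^ 'm \<Rightarrow> real"
    and \<Phi> :: "'m \<Rightarrow> real \<Rightarrow> real"
    and \<omega> :: "real ^ 'm ^ 'n \<Rightarrow> real ^ 'm \<Rightarrow> real"
  assumes "market_network N"
    and "\<And>i. admissible_cost (\<Psi> i)"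
    and "\<And>j. admissible_inverse_demand (\<Phi> j)"
    and "admissible_welfare \<omega>"
  shows "\<exists>x y. nash_equilibrium N \<Psi> \<Phi> \<omega> x y"
proof -
  define M where "M = (\<Sum>k\<in>links N. cap_minus N k + cap_plus N k)"
  have M: "\<bar>z $ j\<bar> \<le> M" if "z \<in> feasible_imports N" for z j
    unfolding M_def using feasible_imports_bound[OF assms(1) that] .
  have "0 \<le> M" using M[OF zero_feasible_import[OF assms(1)]] by simp
  have "\<exists>z>0. \<Phi> j z = 0" for j
    using assms(3) by (simp add: admissible_inverse_demand_def)
  then obtain zb where zb: "\<And>j. zb j > 0" "\<And>j. \<Phi> j (zb j) = 0" by metis
  \<comment> \<open>The sum is at least each zero \<open>zb j\<close>, and \<open>M\<close> offsets
    the largest possible net export, so \<open>R + z $ j\<close> is at least \<open>zb j\<close> for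
    every feasible \<open>z\<close>.\<close>
  define R where "R = M + (\<Sum>j\<in>UNIV. zb j)"
  have R0: "0 \<le> R" unfolding R_def using \<open>0 \<le> M\<close> zb(1) by (simp add: sum_nonneg less_imp_le)
  have price: "\<Phi> j (R + z $ j) \<le> 0" if "z \<in> feasible_imports N" for z j
  proof -
    have "zb j \<le> (\<Sum>j\<in>UNIV. zb j)" using zb(1) by (intro member_le_sum) (auto simp: less_imp_le)
    then have "zb j \<le> R + z $ j" using M[OF that, of j] by (simp add: R_def abs_le_iff)
    then show ?thesis
      using antimonoD[OF antimono_inverse_demand[OF assms(3)]] zb(2) by metis
  qed
  define P :: "(real ^ 'm ^ 'n) set" where
    "P = {x \<in> {0..(\<chi> i. \<chi> j. R)}. \<forall>i j. adj N i j = 0 \<longrightarrow> x $ i $ j = 0}"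
  define S where "S = P \<times> feasible_imports N"
  have P_eq: "P = {0..(\<chi> i. \<chi> j. R)} \<inter> (\<Inter>i. \<Inter>j. {x. adj N i j = 0 \<longrightarrow> x $ i $ j = 0})"
    by (auto simp: P_def)
  have "closed {x :: real ^ 'm ^ 'n. adj N i j = 0 \<longrightarrow> x $ i $ j = 0}" for i j
    by (cases "adj N i j = 0") (auto intro!: closed_Collect_eq continuous_intros)
  then have "compact P"
    unfolding P_eq by (intro compact_Int_closed compact_interval closed_INT ballI)
  then have S1: "compact S"
    unfolding S_def by (intro compact_Times compact_feasible_imports assms(1))
  have "convex P"
    unfolding convex_def P_def
    by (auto simp: less_eq_vec_def intro!: convex_bound_le)
  then have S2: "convex S"
    unfolding S_def by (intro convex_Times convex_feasible_imports assms(1))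
  have "0 \<in> P" using R0 by (simp add: P_def less_eq_vec_def)
  then have S3: "S \<noteq> {}"
    unfolding S_def using zero_feasible_import[OF assms(1)] by blast
  have P_nonneg: "x \<in> {0..}" "x $ i \<in> {0..}" if "x \<in> P" for x i
    using that by (auto simp: P_def less_eq_vec_def)
  then have S_nonneg: "fst s \<in> {0..}" "fst s $ i \<in> {0..}" if "s \<in> S" for s i
    using that unfolding S_def mem_Times_iff by blast+
  \<comment> \<open>The Nikaido-Isoda function: the operator's term takes only the imports from
    \<open>t\<close>, the profit of \<open>i\<close> only row \<open>i\<close> of the production;
    everything else stays at \<open>s\<close>.\<close>
  define F where "F s t = \<omega> (fst s) (sales N (fst s) + snd t)
      + (\<Sum>i\<in>UNIV. profit N \<Psi> \<Phi> i (fst t $ i) (fst s) (snd s))"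
    for s t :: "(real ^ 'm ^ 'n) \<times> (real ^ 'm)"
  \<comment> \<open>Letting \<open>t\<close> depend on \<open>s\<close> yields both continuity
    hypotheses of Ky Fan's inequality: \<open>t\<close> is constant for one and the identity for the
    other.\<close>
  have cont: "continuous_on S (\<lambda>s. F s (t s))" if t: "continuous_on S t" "t ` S \<subseteq> S" for t
  proof -
    have "continuous_on S (\<lambda>s. sales N (fst s) + snd (t s))"
      unfolding sales_def using t by (intro continuous_intros)
    then have g: "continuous_on S (\<lambda>s. (fst s, sales N (fst s) + snd (t s)))"
      by (intro continuous_on_Pair continuous_on_fst continuous_on_id)
    have w: "continuous_on ({0..} \<times> UNIV) (\<lambda>(x, z). \<omega> x z)"
      using assms(4) by (simp add: admissible_welfare_def)
    have "continuous_on S (\<lambda>s. \<omega> (fst s) (sales N (fst s) + snd (t s)))"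
      using continuous_on_compose2[OF w g] S_nonneg(1) by fastforce
    moreover have "continuous_on S (\<lambda>s. profit N \<Psi> \<Phi> i (fst (t s) $ i) (fst s) (snd s))" for i
    proof (intro continuous_on_profit assms)
      show "(\<lambda>s. fst (t s) $ i) ` S \<subseteq> {0..}"
        using t(2) S_nonneg(2) by blast
    qed (use t in \<open>auto intro!: continuous_intros\<close>)
    ultimately show ?thesis
      unfolding F_def by (intro continuous_on_add continuous_on_sum) simp_all
  qed
  have conc: "concave_on S (F s)" if "s \<in> S" for s
    unfolding F_def
  proof (intro concave_on_add concave_on_finite_sum S2 finite)
    have "concave_on UNIV (\<omega> (fst s))"
      using assms(4) S_nonneg(1)[OF that] by (simp add: admissible_welfare_def)
    then show "concave_on S (\<lambda>t. \<omega> (fst s) (sales N (fst s) + snd t))"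
      by (rule concave_on_affine_comp) (auto simp: S2 scaleR_right_distrib simp flip: scaleR_left_distrib)
    show "concave_on S (\<lambda>t. profit N \<Psi> \<Phi> i (fst t $ i) (fst s) (snd s))" for i
      using concave_on_profit[OF assms(1-3)] S2
      by (rule concave_on_affine_comp) (use S_nonneg(2) in auto)
  qed
  obtain s where "s \<in> S" and s: "\<And>t. t \<in> S \<Longrightarrow> F s t \<le> F s s"
  proof (rule ky_fan_inequality[OF S1 S2 S3])
    show "continuous_on S (\<lambda>s. F s t)" if "t \<in> S" for t
      using cont[of "\<lambda>_. t"] that by auto
    show "continuous_on S (\<lambda>s. F s s)"
      using cont[of "\<lambda>s. s"] by simp
  qed (use conc in blast)+
  obtain x z where xz: "s = (x, z)" "x \<in> P" "z \<in> feasible_imports N"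
    using \<open>s \<in> S\<close> by (auto simp: S_def)
  obtain y where y: "y \<in> operator_actions N" "z = net_import N y"
    using xz(3) by (auto simp: feasible_imports_def)
  have xP: "x \<in> producer_profiles N"
    using xz(2) by (auto simp: P_def producer_profiles_def producer_actions_def less_eq_vec_def)
  \<comment> \<open>For a \<open>t\<close> that differs from \<open>s\<close> only in the imports,
    all profits cancel from \<open>F s t \<le> F s s\<close>.\<close>
  have op: "operator_utility N \<omega> y' x \<le> operator_utility N \<omega> y x" if "y' \<in> operator_actions N" for y'
    using s[of "(x, net_import N y')"] that xz y
    by (simp add: S_def F_def operator_utility_def market_supply_eq feasible_imports_def)
  have prod: "profit N \<Psi> \<Phi> i v x z \<le> profit N \<Psi> \<Phi> i (x $ i) x z"
    if v: "v \<in> producer_actions N i" for i v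
  proof -
    let ?w = "(\<chi> j. min (v $ j) R)"
    have v0: "0 \<le> v" using v by (simp add: producer_actions_def)
    \<comment> \<open>The deviation cut at \<open>R\<close> is admissible in the truncated game.
      Only producer \<open>i\<close> moves, so the operator's term and the other profits cancel;
      \<open>profit_truncate\<close> then handles the uncut deviation.\<close>
    have "deviate x i ?w \<in> P"
      using xz(2) v R0 by (auto simp: P_def deviate_def producer_actions_def less_eq_vec_def)
    then have "F s (deviate x i ?w, z) \<le> F s s" using s xz by (simp add: S_def)
    then have "profit N \<Psi> \<Phi> i ?w x z \<le> profit N \<Psi> \<Phi> i (x $ i) x z"
      by (simp add: F_def xz deviate_def sum.remove[of UNIV i])
    moreover have "0 \<le> x" using P_nonneg(1)[OF xz(2)] by simp
    ultimately show ?thesis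
      using profit_truncate[where \<Psi> = \<Psi> and i = i and x = x, OF assms(1-3) _ v0 R0 price[OF xz(3)]]
      by fastforce
  qed
  have "deviate x i (x $ i) = x" for i by (simp add: deviate_def vec_eq_iff)
  then have "nash_equilibrium N \<Psi> \<Phi> \<omega> x y"
    unfolding nash_equilibrium_def is_arg_max_def producer_utility_deviate
    using xP y op prod by (auto simp: not_less producer_profiles_def)
  then show ?thesis by blast
qed

end
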